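(* For a real number $r$, the spectrum $\{1,r\}$ can be realized by a uniform ($2\times 2$ complex) matrix if and only if $r=0$ or $r=-1$.
   Context: A complex square matrix is uniform if all its entries have the same absolute value. A multiset of $n$ complex numbers is realized by an $n\times n$ matrix $B$ if it is the multiset of eigenvalues of $B$ (with algebraic multiplicity). *)

theory Defs
  imports
    Complex_Main
    "HOL-Library.Multiset"
    "HOL-Computational_Algebra.Polynomial"
    "Jordan_Normal_Form.Char_Poly"
begin

definition uniform_mat :: "complex mat \<Rightarrow> bool" where
  "uniform_mat A \<longleftrightarrow> square_mat A \<and>
     (\<forall>a \<in> elements_mat A. \<forall>b \<in> elements_mat A. cmod a = cmod b)"

text \<open>Algebraic multiplicity of an eigenvalue is its multiplicity as a root of the
  characteristic polynomial. Only meaningful for square matrices.\<close>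

definition eigenvalue_mset :: "complex mat \<Rightarrow> complex multiset" where
  "eigenvalue_mset A = proots (char_poly A)"

definition realizes :: "complex mat \<Rightarrow> complex multiset \<Rightarrow> bool" where
  "realizes B M \<longleftrightarrow> B \<in> carrier_mat (size M) (size M) \<and> eigenvalue_mset B = M"

end

theory Submission
  imports Defs
begin

text \<open>
  If $B$ has rows $(a,b)$ and $(c,d)$, all of modulus $s$, its spectrum is $1, r$ iff
  $a + d = 1 + r$ and $ad - bc = r$. If the trace is nonzero, being real it forces $d = \bar a$, so
  $bc = s^2 - r$ is a real number of modulus $s^2$. Hence $r = 0$ or $r = 2s^2$, and in the latter
  case $1 + 2s^2 = 2\,\mathrm{Re}\,a \le 2s$ is impossible.
\<close>

lemma det_mat_2:
  fixes A :: "'a :: comm_ring_1 mat"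
  assumes "A \<in> carrier_mat 2 2"
  shows "det A = A $$ (0,0) * A $$ (1,1) - A $$ (0,1) * A $$ (1,0)"
proof -
  have "mat_delete A i 0 \<in> carrier_mat 1 1" for i
    using assms by (simp add: mat_delete_def)
  then have "det (mat_delete A i 0) = mat_delete A i 0 $$ (0,0)" for i
    by (rule det_single)
  moreover have "det A = (\<Sum>i<2. A $$ (i,0) * cofactor A i 0)"
    using laplace_expansion_column[OF assms, of 0] by simp
  ultimately show ?thesis
    using assms by (simp add: cofactor_def mat_delete_def numeral_2_eq_2 algebra_simps)
qed

lemma char_poly_mat_2:
  fixes B :: "'a :: comm_ring_1 mat"
  assumes "B \<in> carrier_mat 2 2"
  shows "char_poly B = [: B $$ (0,0) * B $$ (1,1) - B $$ (0,1) * B $$ (1,0),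
    - (B $$ (0,0) + B $$ (1,1)), 1 :]"
proof -
  have "char_poly_matrix B \<in> carrier_mat 2 2"
    using assms by simp
  then have "char_poly B = char_poly_matrix B $$ (0,0) * char_poly_matrix B $$ (1,1)
      - char_poly_matrix B $$ (0,1) * char_poly_matrix B $$ (1,0)"
    unfolding char_poly_def by (rule det_mat_2)
  then show ?thesis
    using assms by (simp add: char_poly_matrix_def algebra_simps)
qed

lemma proots_linear_product:
  fixes x y :: "'a :: idom"
  shows "proots ([: -x, 1 :] * [: -y, 1 :]) = {# x, y #}"
  by (subst proots_mult) auto

text \<open>Over the complex numbers the monic characteristic polynomial is the product of the
  linear factors of its roots, so fixing the spectrum amounts to fixing two coefficients. This
  reduces the problem to equations in the four entries.\<close>

lemma eigenvalue_mset_2_iff: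
  assumes B: "B \<in> carrier_mat 2 2"
  shows "eigenvalue_mset B = {# x, y #} \<longleftrightarrow>
    B $$ (0,0) + B $$ (1,1) = x + y \<and>
    B $$ (0,0) * B $$ (1,1) - B $$ (0,1) * B $$ (1,0) = x * y"
    (is "_ \<longleftrightarrow> ?t = _ \<and> ?d = _")
proof
  assume *: "eigenvalue_mset B = {# x, y #}"
  have monic: "lead_coeff (char_poly B) = 1"
    by (simp add: char_poly_mat_2[OF B])
  have "char_poly B = (\<Prod>z\<in>#proots (char_poly B). [: -z, 1 :])"
    using complex_poly_decompose_multiset[of "char_poly B"] monic by simp
  also have "\<dots> = [: -x, 1 :] * [: -y, 1 :]"
    using * by (simp add: eigenvalue_mset_def)
  finally show "?t = x + y \<and> ?d = x * y"
    by (auto simp: char_poly_mat_2[OF B] algebra_simps)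
next
  assume "?t = x + y \<and> ?d = x * y"
  then have "char_poly B = [: -x, 1 :] * [: -y, 1 :]"
    unfolding char_poly_mat_2[OF B] by simp
  then show "eigenvalue_mset B = {# x, y #}"
    unfolding eigenvalue_mset_def by (simp only: proots_linear_product)
qed

lemma uniform_mat_2_iff:
  assumes "B \<in> carrier_mat 2 2"
  shows "uniform_mat B \<longleftrightarrow> cmod (B $$ (0,1)) = cmod (B $$ (0,0)) \<and>
    cmod (B $$ (1,0)) = cmod (B $$ (0,0)) \<and> cmod (B $$ (1,1)) = cmod (B $$ (0,0))"
proof -
  have "{0..<2::nat} = {0,1}" by auto
  then have "elements_mat B = {B $$ (0,0), B $$ (0,1), B $$ (1,0), B $$ (1,1)}"
    using assms unfolding elements_mat_def by auto
  then show ?thesis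
    using assms unfolding uniform_mat_def by auto
qed

text \<open>A real sum makes the imaginary parts opposite, so equal moduli leave real parts that
  agree up to sign. Opposite real parts would give sum 0, which \<open>t \<noteq> 0\<close>
  excludes.\<close>

lemma eq_cnj_if_same_cmod_and_sum_real:
  assumes "cmod d = cmod a" "a + d = of_real t" "t \<noteq> 0"
  shows "d = cnj a"
proof -
  have im: "Im d = - Im a" and re: "Re a + Re d = t"
    using assms(2) by (auto simp: complex_eq_iff)
  have "(Re d)\<^sup>2 = (Re a)\<^sup>2"
    using assms(1) im by (simp add: cmod_def)
  then have "Re d = Re a"
    using re assms(3) by (auto simp: power2_eq_iff)
  with im show ?thesis by (simp add: complex_eq_iff)
qed

lemma trace_det_same_cmod:
  fixes r :: real
  assumes b: "cmod b = cmod a" and c: "cmod c = cmod a" and d: "cmod d = cmod a"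
    and tr: "a + d = 1 + of_real r" and det: "a * d - b * c = of_real r"
  shows "r = 0 \<or> r = -1"
proof (rule ccontr)
  assume r: "\<not> (r = 0 \<or> r = -1)"
  \<comment> \<open>Here \<open>r \<noteq> -1\<close> is what makes the trace nonzero.\<close>
  have "a + d = of_real (1 + r)" using tr by simp
  then have d_eq: "d = cnj a"
    using eq_cnj_if_same_cmod_and_sum_real[OF d, of "1 + r"] r by simp
  have "b * c = of_real ((cmod a)\<^sup>2 - r)"
    using det unfolding d_eq complex_norm_square[symmetric] by (simp add: algebra_simps)
  then have "\<bar>(cmod a)\<^sup>2 - r\<bar> = cmod (b * c)"
    by (simp only: norm_of_real)
  also have "\<dots> = (cmod a)\<^sup>2"
    using b c by (simp add: norm_mult power2_eq_square)
  \<comment> \<open>Dropping the absolute value leaves \<open>r = 0\<close>, which is excluded, or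
    this.\<close>
  finally have "r = 2 * (cmod a)\<^sup>2"
    using r by linarith
  moreover have "1 + r = 2 * Re a"
    using tr unfolding d_eq by (simp add: complex_eq_iff)
  \<comment> \<open>With \<open>m = cmod a\<close>, this is
    \<open>1 + 2 * m\<^sup>2 \<le> 2 * m\<close> written as a sum of squares; both would have to
    vanish, forcing \<open>m = 1\<close> and \<open>m = 0\<close>.\<close>
  ultimately have "(1 - cmod a)\<^sup>2 + (cmod a)\<^sup>2 \<le> 0"
    using complex_Re_le_cmod[of a] by (simp add: power2_eq_square algebra_simps)
  then show False
    by (smt (verit) zero_le_power2 power2_eq_iff_nonneg zero_eq_power2)
qed

theorem theorem7p6:
  fixes r :: real
  shows "(\<exists>B \<in> carrier_mat 2 2. uniform_mat B \<and> realizes B {#1, complex_of_real r#})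
    \<longleftrightarrow> r = 0 \<or> r = -1"
proof
  assume "\<exists>B \<in> carrier_mat 2 2. uniform_mat B \<and> realizes B {#1, complex_of_real r#}"
  then obtain B where B: "B \<in> carrier_mat 2 2" "uniform_mat B"
    "eigenvalue_mset B = {#1, complex_of_real r#}"
    by (auto simp: realizes_def)
  show "r = 0 \<or> r = -1"
    using B(2,3) unfolding uniform_mat_2_iff[OF B(1)] eigenvalue_mset_2_iff[OF B(1)]
    by (intro trace_det_same_cmod[of "B $$ (0,1)" "B $$ (0,0)" "B $$ (1,0)" "B $$ (1,1)"]) auto
next
  define s :: complex where "s = of_real (1 / sqrt 2)"
  have s: "s * s = 1 / 2"
    unfolding s_def of_real_mult[symmetric] by simp
  \<comment> \<open>For \<open>r = 0\<close>, a rank-one matrix of trace 1. For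
    \<open>r = -1\<close>, the Hadamard matrix of order 2 scaled by \<open>s\<close>: its trace is 0
    and its determinant \<open>- 2 * s * s = -1\<close>.\<close>
  define B where "B = (if r = 0 then mat 2 2 (\<lambda>_. 1 / 2)
    else mat 2 2 (\<lambda>(i, j). if i = 1 \<and> j = 1 then - s else s))"
  assume "r = 0 \<or> r = -1"
  moreover have B: "B \<in> carrier_mat 2 2" by (simp add: B_def)
  ultimately have "uniform_mat B" "eigenvalue_mset B = {#1, complex_of_real r#}"
    unfolding uniform_mat_2_iff[OF B] eigenvalue_mset_2_iff[OF B]
    by (auto simp: B_def s)
  with B show "\<exists>B \<in> carrier_mat 2 2. uniform_mat B \<and> realizes B {#1, complex_of_real r#}"
    by (auto simp: realizes_def numeral_2_eq_2)
qed

end
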